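(* Let $\mu$ be a $\sigma$-additive measure on a set $X$, with $\sigma$-algebra of measurable sets $\mathcal C_X$, and let $A$ be a complete Abelian $\Omega$-group. If $f:X\to A$ is a map integrable on $X$, then for any $\epsilon\in\mathbb R$, $\epsilon>0$, there is $\delta>0$ such that $$\left\|\int_E d\mu(x)f(x)\right\|<\epsilon$$ for any $E\in\mathcal C_X$ such that $\mu(E)<\delta$.
   Context: $\Omega$-group: a group $(A,+)$ with a set $\Omega$ of further operations $\omega$, each additive in each argument; Abelian means $+$ is commutative. A norm on $A$ is a map $a\mapsto\|a\|\in\mathbb R$ with $\|a\|\ge0$, $\|a\|=0\iff a=0$, $\|a+b\|\le\|a\|+\|b\|$, $\|-a\|=\|a\|$. Standing assumption: $A$ is a normed Abelian $\Omega$-group, complete for its norm, carrying an effective action of $\mathbb R$, i.e. $A$ is a real vector space, with $\|ra\|=|r|\,\|a\|$. A $\sigma$-additive measure on $X$ is a map $\mu$ from a $\sigma$-algebra of subsets of $X$ (containing $X$) to $\mathbb R$, nonnegative and countably additive (so $\mu(X)<\infty$); it is assumed complete. The Borel algebra of $A$ is the $\sigma$-algebra generated by all open balls; $f:X\to A$ is $\mu$-measurable if preimages of its members are $\mu$-measurable. A simple map is a $\mu$-measurable map with finite or countable range. A simple map $f$ with distinct values $f_1,f_2,\dots$ and $F_n=\{x:f(x)=f_n\}$ is integrable over $X$ if $\sum_n\|\mu(F_n)f_n\|<\infty$, and then $\int_X d\mu(x)f(x)=\sum_n\mu(F_n)f_n$. A $\mu$-measurable map $f$ is integrable over $X$ if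 it is the uniform limit of a sequence of simple integrable maps $f_n$; then $\int_X d\mu(x)f(x)=\lim_{n\to\infty}\int_X d\mu(x)f_n(x)$. Integrals over a measurable subset $E$ are defined likewise with the restricted map and measure. *)

theory Defs
  imports "HOL-Analysis.Analysis"
begin

text \<open>An Abelian group with a family of operations of arbitrary finite arities. The
  operation named by \<open>w\<close> acts on lists of length \<open>arity w\<close>; its values on other lists are irrelevant.\<close>

locale abelian_omega_group =
  fixes Omega :: "'w set"
    and arity :: "'w \<Rightarrow> nat"
    and opn :: "'w \<Rightarrow> 'a::ab_group_add list \<Rightarrow> 'a"
  assumes additive_in_each_argument:
    "\<And>w xs i a b. w \<in> Omega \<Longrightarrow> length xs = arity w \<Longrightarrow> i < arity w \<Longrightarrow>
       opn w (xs[i := a + b]) = opn w (xs[i := a]) + opn w (xs[i := b])"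

text \<open>The \<open>\<sigma>\<close>-algebra generated by the open balls. In a non-separable space it can be
  strictly smaller than \<open>borel\<close>, which is generated by all open sets.\<close>

definition ball_algebra :: "'a::metric_space measure" where
  "ball_algebra = sigma UNIV {ball a r | a r. r > 0}"

definition simple_map :: "'x measure \<Rightarrow> ('x \<Rightarrow> 'a::metric_space) \<Rightarrow> bool" where
  "simple_map M f \<longleftrightarrow> f \<in> measurable M ball_algebra \<and> countable (f ` space M)"

text \<open>The sums run over the countable set of distinct values of \<open>f\<close> on the space, so no
  enumeration is needed: absolute convergence makes the sum independent of the order.\<close>

definition simple_map_integrable :: "'x measure \<Rightarrow> ('x \<Rightarrow> 'a::banach) \<Rightarrow> bool" where
  "simple_map_integrable M f \<longleftrightarrow> simple_map M f \<and>
     (\<lambda>v. norm (measure M {x \<in> space M. f x = v} *\<^sub>R v)) summable_on (f ` space M)"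

definition simple_map_integral :: "'x measure \<Rightarrow> ('x \<Rightarrow> 'a::banach) \<Rightarrow> 'a" where
  "simple_map_integral M f =
     (\<Sum>\<^sub>\<infinity>v\<in>f ` space M. measure M {x \<in> space M. f x = v} *\<^sub>R v)"

definition simple_approximation ::
    "'x measure \<Rightarrow> ('x \<Rightarrow> 'a::banach) \<Rightarrow> (nat \<Rightarrow> 'x \<Rightarrow> 'a) \<Rightarrow> bool" where
  "simple_approximation M f g \<longleftrightarrow>
     (\<forall>n. simple_map_integrable M (g n)) \<and> uniform_limit (space M) g f sequentially"

definition map_integrable :: "'x measure \<Rightarrow> ('x \<Rightarrow> 'a::banach) \<Rightarrow> bool" where
  "map_integrable M f \<longleftrightarrow>
     f \<in> measurable M ball_algebra \<and> (\<exists>g. simple_approximation M f g)"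

text \<open>For integrable \<open>f\<close> and finite \<open>M\<close> the limit exists for every approximating sequence
  and does not depend on it.\<close>

definition map_integral :: "'x measure \<Rightarrow> ('x \<Rightarrow> 'a::banach) \<Rightarrow> 'a" where
  "map_integral M f =
     (THE I. \<exists>g. simple_approximation M f g \<and> (\<lambda>n. simple_map_integral M (g n)) \<longlonglongrightarrow> I)"

definition map_integral_over :: "'x measure \<Rightarrow> 'x set \<Rightarrow> ('x \<Rightarrow> 'a::banach) \<Rightarrow> 'a" where
  "map_integral_over M E f = map_integral (restrict_space M E) f"

end

theory Submission
  imports Defs
begin

text \<open>A simple map integrates over \<open>E\<close> to something of norm at most the sum of
  \<open>\<mu>(E \<inter> F\<^sub>v) \<parallel>v\<parallel>\<close> over its values \<open>v\<close>. Finitely many values contribute at most a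
  constant times \<open>\<mu>(E)\<close>, the others at most a tail of the convergent series of the \<open>\<mu>(F\<^sub>v) \<parallel>v\<parallel>\<close>,
  which does not depend on \<open>E\<close>. An integrable map is uniformly within distance 1 of such a simple
  map, which changes the integral over \<open>E\<close> by at most \<open>\<mu>(E)\<close>.\<close>

section \<open>Countable additivity over the level sets of simple maps\<close>

lemma (in finite_measure) has_sum_measure_UN:
  assumes "countable I" and A: "\<And>i. i \<in> I \<Longrightarrow> A i \<in> sets M" and dis: "disjoint_family_on A I"
  shows "((\<lambda>i. measure M (A i)) has_sum measure M (\<Union>i\<in>I. A i)) I"
proof (cases "finite I")
  case True
  have "measure M (\<Union>i\<in>I. A i) = (\<Sum>i\<in>I. measure M (A i))"
    by (rule finite_measure_finite_Union) (use True A dis in auto)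
  then show ?thesis
    using True by (simp add: has_sum_finite)
next
  case False
  \<comment> \<open>On a finite set \<open>from_nat_into\<close> repeats elements, which would
    destroy disjointness; hence the case split. This is the only place where an index set is
    enumerated; later sums are indexed by the values themselves.\<close>
  have bij: "bij_betw (from_nat_into I) UNIV I"
    using assms(1) False by (rule bij_betw_from_nat_into)
  have mem: "from_nat_into I n \<in> I" for n
    using bij by (auto simp: bij_betw_def)
  have "(\<lambda>n. measure M (A (from_nat_into I n))) sums measure M (\<Union>n. A (from_nat_into I n))"
  proof (rule finite_measure_UNION)
    show "range (\<lambda>n. A (from_nat_into I n)) \<subseteq> sets M"
      using A mem by auto
    show "disjoint_family (\<lambda>n. A (from_nat_into I n))"
      using dis mem bij unfolding disjoint_family_on_def bij_betw_def inj_on_def by (metis UNIV_I)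
  qed
  moreover have "(\<Union>n. A (from_nat_into I n)) = (\<Union>i\<in>I. A i)"
    using bij by (metis bij_betw_imp_surj_on image_image)
  \<comment> \<open>Nonnegative terms make the ordered series converge unconditionally.\<close>
  ultimately have "((\<lambda>n. measure M (A (from_nat_into I n))) has_sum measure M (\<Union>i\<in>I. A i)) UNIV"
    by (intro sums_nonneg_imp_has_sum) auto
  then show ?thesis
    using has_sum_reindex_bij_betw[OF bij, of "\<lambda>i. measure M (A i)"] by simp
qed

text \<open>That points are closed is not enough here, since \<open>ball_algebra\<close> can miss
  open sets. A point is instead the intersection of countably many balls around it, which makes
  level sets of simple maps measurable.\<close>

lemma singleton_in_ball_algebra: "{v} \<in> sets (ball_algebra :: 'a::metric_space measure)"
proof -
  have "ball v (1 / Suc n) \<in> sets (ball_algebra :: 'a measure)" for n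
    unfolding ball_algebra_def by (rule in_measure_of) (auto intro!: exI[of _ v] exI[of _ "1 / Suc n"])
  then have "(\<Inter>n. ball v (1 / Suc n)) \<in> sets ball_algebra"
    by auto
  moreover have "(\<Inter>n. ball v (1 / Suc n)) = {v}"
  proof -
    have "u = v" if "\<And>n. dist v u < 1 / Suc n" for u
    proof (rule ccontr)
      assume "u \<noteq> v"
      then obtain n where "1 / real (Suc n) < dist v u"
        using nat_approx_posE[of "dist v u"] by auto
      with that[of n] show False by simp
    qed
    then show ?thesis by auto
  qed
  ultimately show ?thesis by simp
qed

lemma simple_map_level_set:
  assumes "simple_map M g"
  shows "{x \<in> space M. g x = v} \<in> sets M"
proof -
  have "g -` {v} \<inter> space M \<in> sets M"
    using assms singleton_in_ball_algebra[of v] unfolding simple_map_def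
    by (blast intro: measurable_sets)
  moreover have "g -` {v} \<inter> space M = {x \<in> space M. g x = v}"
    by auto
  ultimately show ?thesis by simp
qed

lemma simple_map_joint_level_set:
  assumes "simple_map M g" and "simple_map M h"
  shows "{x \<in> space M. g x = v \<and> h x = w} \<in> sets M"
  using sets.Int[OF simple_map_level_set[OF assms(1), of v] simple_map_level_set[OF assms(2), of w]]
  by (simp add: Int_def conj_ac)

lemma (in finite_measure) has_sum_level_sets:
  assumes "simple_map M g"
  shows "((\<lambda>v. measure M {x \<in> space M. g x = v}) has_sum measure M (space M)) (g ` space M)"
proof -
  have "((\<lambda>v. measure M {x \<in> space M. g x = v})
      has_sum measure M (\<Union>v\<in>g ` space M. {x \<in> space M. g x = v})) (g ` space M)"
    using assms simple_map_level_set[OF assms]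
    by (intro has_sum_measure_UN) (auto simp: simple_map_def disjoint_family_on_def)
  moreover have "(\<Union>v\<in>g ` space M. {x \<in> space M. g x = v}) = space M"
    by auto
  ultimately show ?thesis by simp
qed

lemma (in finite_measure) has_sum_joint_level_sets:
  assumes g: "simple_map M g" and h: "simple_map M h"
  shows "((\<lambda>w. measure M {x \<in> space M. g x = v \<and> h x = w})
    has_sum measure M {x \<in> space M. g x = v}) (h ` space M)"
proof -
  have "((\<lambda>w. measure M {x \<in> space M. g x = v \<and> h x = w})
      has_sum measure M (\<Union>w\<in>h ` space M. {x \<in> space M. g x = v \<and> h x = w})) (h ` space M)"
    using h simple_map_joint_level_set[OF g h]
    by (intro has_sum_measure_UN) (auto simp: simple_map_def disjoint_family_on_def)
  moreover have "(\<Union>w\<in>h ` space M. {x \<in> space M. g x = v \<and> h x = w}) = {x \<in> space M. g x = v}"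
    by auto
  ultimately show ?thesis by simp
qed

section \<open>Comparing two simple maps on their common refinement\<close>

lemma has_sum_scaleR_left_const:
  fixes c :: "'a::real_normed_vector"
  assumes "(f has_sum s) A"
  shows "((\<lambda>x. f x *\<^sub>R c) has_sum s *\<^sub>R c) A"
  by (rule has_sum_bounded_linear[OF bounded_linear_scaleR_left assms])

text \<open>Summing first over \<open>w\<close> gives the mass of a level set of \<open>g\<close>,
  then over \<open>v\<close> the total mass; nonnegativity makes the double family summable. It
  serves as the dominating series when two integrals are compared.\<close>

lemma (in finite_measure) has_sum_joint_measure:
  assumes g: "simple_map M g" and h: "simple_map M h"
  shows "((\<lambda>(v, w). measure M {x \<in> space M. g x = v \<and> h x = w}) has_sum measure M (space M))
    (g ` space M \<times> h ` space M)"
proof (rule has_sum_SigmaI)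
  show "(\<lambda>(v, w). measure M {x \<in> space M. g x = v \<and> h x = w})
      summable_on (g ` space M \<times> h ` space M)"
    by (rule summable_on_SigmaI[OF _ has_sum_imp_summable[OF has_sum_level_sets[OF g]]])
      (use has_sum_joint_level_sets[OF g h] in auto)
qed (use has_sum_joint_level_sets[OF g h] has_sum_level_sets[OF g] in auto)

text \<open>Splitting each level set of \<open>g\<close> along the values of \<open>h\<close> leaves
  the integral of \<open>g\<close> unchanged, but puts it over the same index set as that of
  \<open>h\<close>, so that the two can be subtracted term by term.\<close>

lemma (in finite_measure) has_sum_joint_left:
  fixes g :: "'a \<Rightarrow> 'b::banach"
  assumes g: "simple_map_integrable M g" and h: "simple_map M h"
  shows "((\<lambda>(v, w). measure M {x \<in> space M. g x = v \<and> h x = w} *\<^sub>R v)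
    has_sum simple_map_integral M g) (g ` space M \<times> h ` space M)"
proof -
  have gs: "simple_map M g"
    and abs: "(\<lambda>v. measure M {x \<in> space M. g x = v} *\<^sub>R v) abs_summable_on (g ` space M)"
    using g by (simp_all add: simple_map_integrable_def)
  note joint = has_sum_joint_level_sets[OF gs h]
  show ?thesis
  proof (rule has_sum_SigmaI)
    show "((\<lambda>w. (\<lambda>(v, w). measure M {x \<in> space M. g x = v \<and> h x = w} *\<^sub>R v) (v, w))
        has_sum measure M {x \<in> space M. g x = v} *\<^sub>R v) (h ` space M)" for v
      using has_sum_scaleR_left_const[OF joint, where c = v and v1 = v] by simp
    show "((\<lambda>v. measure M {x \<in> space M. g x = v} *\<^sub>R v)
        has_sum simple_map_integral M g) (g ` space M)"
      unfolding simple_map_integral_def by (rule has_sum_infsum[OF abs_summable_summable[OF abs]])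
    \<comment> \<open>For fixed \<open>v\<close> the norms add up without loss, because the vector
      \<open>v\<close> is constant along the inner sum. The double family is thus absolutely
      summable, and completeness gives summability.\<close>
    have "((\<lambda>w. norm (measure M {x \<in> space M. g x = v \<and> h x = w} *\<^sub>R v))
        has_sum norm (measure M {x \<in> space M. g x = v} *\<^sub>R v)) (h ` space M)" for v
      using has_sum_scaleR_left_const[OF joint, where c = "norm v" and v1 = v] by simp
    then have "(\<lambda>(v, w). measure M {x \<in> space M. g x = v \<and> h x = w} *\<^sub>R v)
        abs_summable_on (g ` space M \<times> h ` space M)"
      by (intro summable_on_SigmaI[OF _ abs]) auto
    then show "(\<lambda>(v, w). measure M {x \<in> space M. g x = v \<and> h x = w} *\<^sub>R v)
        summable_on (g ` space M \<times> h ` space M)"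
      by (rule abs_summable_summable)
  qed
qed

lemma (in finite_measure) has_sum_joint_right:
  fixes h :: "'a \<Rightarrow> 'b::banach"
  assumes g: "simple_map M g" and h: "simple_map_integrable M h"
  shows "((\<lambda>(v, w). measure M {x \<in> space M. g x = v \<and> h x = w} *\<^sub>R w)
    has_sum simple_map_integral M h) (g ` space M \<times> h ` space M)"
proof -
  have "bij_betw prod.swap (g ` space M \<times> h ` space M) (h ` space M \<times> g ` space M)"
    by (auto simp: bij_betw_def inj_on_def)
  from has_sum_reindex_bij_betw[OF this, THEN iffD2, OF has_sum_joint_left[OF h g]]
  show ?thesis
    by (simp add: case_prod_unfold conj_commute)
qed

text \<open>On the common refinement both maps are constant on each piece, so each term of the
  difference is at most \<open>d\<close> times the mass of its piece, and these masses add up to the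
  total mass.\<close>

lemma (in finite_measure) norm_simple_map_integral_diff_le:
  fixes g h :: "'a \<Rightarrow> 'b::banach"
  assumes g: "simple_map_integrable M g" and h: "simple_map_integrable M h"
    and d: "\<And>x. x \<in> space M \<Longrightarrow> norm (g x - h x) \<le> d"
  shows "norm (simple_map_integral M g - simple_map_integral M h) \<le> d * measure M (space M)"
proof -
  have gs: "simple_map M g" and hs: "simple_map M h"
    using g h by (simp_all add: simple_map_integrable_def)
  define m where "m = (\<lambda>p. measure M {x \<in> space M. g x = fst p \<and> h x = snd p})"
  let ?P = "g ` space M \<times> h ` space M"
  have "((\<lambda>p. - (m p *\<^sub>R snd p)) has_sum - simple_map_integral M h) ?P"
    using has_sum_joint_right[OF gs h] by (simp add: has_sum_uminus m_def case_prod_unfold)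
  from has_sum_add[OF has_sum_joint_left[OF g hs] this]
  have diff: "((\<lambda>p. m p *\<^sub>R (fst p - snd p))
      has_sum simple_map_integral M g - simple_map_integral M h) ?P"
    by (simp add: m_def case_prod_unfold scaleR_diff_right)
  have mass: "((\<lambda>p. d * m p) has_sum d * measure M (space M)) ?P"
    using has_sum_cmult_right[OF has_sum_joint_measure[OF gs hs], of d]
    by (simp add: m_def case_prod_unfold)
  have le: "norm (m p *\<^sub>R (fst p - snd p)) \<le> d * m p" for p
  \<comment> \<open>A pair (v, w) need not be attained at a common point. Then nothing bounds v - w,
    but the piece is empty and has mass 0.\<close>
  proof (cases "{x \<in> space M. g x = fst p \<and> h x = snd p} = {}")
    case True
    then show ?thesis by (simp add: m_def del: Collect_empty_eq)
  next
    case False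
    then obtain x where "x \<in> space M" "g x = fst p" "h x = snd p" by auto
    with d[of x] have "norm (fst p - snd p) \<le> d" by simp
    moreover have "0 \<le> m p" by (simp add: m_def)
    ultimately show ?thesis
      by (simp add: mult.commute[of d] mult_left_mono)
  qed
  have abs: "(\<lambda>p. m p *\<^sub>R (fst p - snd p)) abs_summable_on ?P"
    by (rule Infinite_Sum.abs_summable_on_comparison_test'[OF has_sum_imp_summable[OF mass]]) (rule le)
  show ?thesis
    using norm_infsum_bound[OF abs] infsum_mono[OF abs has_sum_imp_summable[OF mass] le]
      infsumI[OF diff] infsumI[OF mass] by simp
qed

section \<open>Existence and uniqueness of the limit that defines the integral\<close>

lemma (in finite_measure) map_integral_limit:
  fixes f :: "'a \<Rightarrow> 'b::banach"
  assumes g: "simple_approximation M f g"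
  shows "(\<lambda>n. simple_map_integral M (g n)) \<longlonglongrightarrow> map_integral M f"
proof -
  \<comment> \<open>Taking both sequences equal gives the Cauchy property; taking two different ones
    gives the independence of the choice that the \<open>THE\<close> in \<open>map_integral\<close>
    requires.\<close>
  have near: "\<exists>N. \<forall>m\<ge>N. \<forall>n\<ge>N.
      norm (simple_map_integral M (g' m) - simple_map_integral M (h' n)) < e"
    if g': "simple_approximation M f g'" and h': "simple_approximation M f h'" and e: "0 < e"
    for g' h' and e :: real
  proof -
    \<comment> \<open>The added 1 keeps \<open>K\<close> positive on a null space and makes it
      strictly larger than the total mass; \<open>d\<close> is chosen so that
      \<open>2 * d * K = e\<close>.\<close>
    define K where "K = measure M (space M) + 1"
    define d where "d = e / (2 * K)"
    have K: "0 < K"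
      by (simp add: K_def add_nonneg_pos)
    have d: "0 < d" using e K by (simp add: d_def)
    obtain N1 where N1: "\<And>n x. n \<ge> N1 \<Longrightarrow> x \<in> space M \<Longrightarrow> dist (g' n x) (f x) < d"
      using g' d unfolding simple_approximation_def uniform_limit_iff eventually_sequentially by blast
    obtain N2 where N2: "\<And>n x. n \<ge> N2 \<Longrightarrow> x \<in> space M \<Longrightarrow> dist (h' n x) (f x) < d"
      using h' d unfolding simple_approximation_def uniform_limit_iff eventually_sequentially by blast
    have "norm (simple_map_integral M (g' m) - simple_map_integral M (h' n)) < e"
      if "m \<ge> max N1 N2" "n \<ge> max N1 N2" for m n
    proof -
      have "norm (g' m x - h' n x) \<le> 2 * d" if "x \<in> space M" for x
        using N1[of m x] N2[of n x] that \<open>m \<ge> max N1 N2\<close> \<open>n \<ge> max N1 N2\<close>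
          dist_triangle2[of "g' m x" "h' n x" "f x"] by (simp add: dist_norm)
      then have "norm (simple_map_integral M (g' m) - simple_map_integral M (h' n))
          \<le> 2 * d * measure M (space M)"
        using g' h' by (intro norm_simple_map_integral_diff_le) (auto simp: simple_approximation_def)
      also have "\<dots> < 2 * d * K"
        using d by (simp add: K_def)
      also have "\<dots> = e"
        using K by (simp add: d_def)
      finally show ?thesis .
    qed
    then show ?thesis by blast
  qed
  have "Cauchy (\<lambda>n. simple_map_integral M (g n))"
    using near[OF g g] by (intro CauchyI)
  then obtain I where I: "(\<lambda>n. simple_map_integral M (g n)) \<longlonglongrightarrow> I"
    using Cauchy_convergent convergent_def by blast
  have "map_integral M f = I"
    unfolding map_integral_def
  proof (rule the_equality)
    show "\<exists>g. simple_approximation M f g \<and> (\<lambda>n. simple_map_integral M (g n)) \<longlonglongrightarrow> I"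
      using g I by blast
  next
    fix J
    assume "\<exists>g. simple_approximation M f g \<and> (\<lambda>n. simple_map_integral M (g n)) \<longlonglongrightarrow> J"
    then obtain h where h: "simple_approximation M f h"
      and J: "(\<lambda>n. simple_map_integral M (h n)) \<longlonglongrightarrow> J" by blast
    have "(\<lambda>n. simple_map_integral M (h n) - simple_map_integral M (g n)) \<longlonglongrightarrow> 0"
      using near[OF h g] by (intro LIMSEQ_I) fastforce
    then have "J - I = 0"
      using tendsto_diff[OF J I] LIMSEQ_unique by blast
    then show "J = I" by simp
  qed
  with I show ?thesis by simp
qed

section \<open>Restriction of simple maps to a measurable subset\<close>

lemma measure_restrict_level_set:
  assumes "E \<in> sets M"
  shows "measure (restrict_space M E) {x \<in> space (restrict_space M E). g x = v}
    = measure M {x \<in> E. g x = v}"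
proof -
  have "E \<subseteq> space M" using assms by (rule sets.sets_into_space)
  moreover from this have "space (restrict_space M E) = E"
    by (auto simp: space_restrict_space)
  ultimately show ?thesis
    using assms by (simp add: measure_restrict_space Int_absorb2)
qed

lemma simple_map_restrict_space:
  assumes "simple_map M g"
  shows "simple_map (restrict_space M E) g"
proof -
  have "g ` space (restrict_space M E) \<subseteq> g ` space M"
    by (auto simp: space_restrict_space)
  then have "countable (g ` space (restrict_space M E))"
    using assms unfolding simple_map_def by (blast intro: countable_subset)
  then show ?thesis
    using assms unfolding simple_map_def by (simp add: measurable_restrict_space1)
qed

context finite_measure
begin

lemma measure_restricted_level_set_le:
  assumes "simple_map M g" and "E \<in> sets M"
  shows "measure M {x \<in> E. g x = v} \<le> measure M {x \<in> space M. g x = v}"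
    and "measure M {x \<in> E. g x = v} \<le> measure M E"
  using sets.sets_into_space[OF assms(2)] assms
  by (auto intro!: finite_measure_mono simp: simple_map_level_set)

text \<open>Passing to \<open>E\<close> can only drop values and shrink level sets, so the series
  over the whole space dominates the new one.\<close>

lemma simple_map_integrable_restrict_space:
  fixes g :: "'a \<Rightarrow> 'b::banach"
  assumes g: "simple_map_integrable M g" and E: "E \<in> sets M"
  shows "simple_map_integrable (restrict_space M E) g"
proof -
  have gs: "simple_map M g"
    and abs: "(\<lambda>v. norm (measure M {x \<in> space M. g x = v} *\<^sub>R v)) summable_on (g ` space M)"
    using g by (simp_all add: simple_map_integrable_def)
  have "g ` space (restrict_space M E) \<subseteq> g ` space M"
    by (auto simp: space_restrict_space)
  then have "(\<lambda>v. norm (measure M {x \<in> space M. g x = v} *\<^sub>R v))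
      summable_on (g ` space (restrict_space M E))"
    using abs summable_on_subset_banach by blast
  then have "(\<lambda>v. measure (restrict_space M E) {x \<in> space (restrict_space M E). g x = v} *\<^sub>R v)
      abs_summable_on (g ` space (restrict_space M E))"
    by (rule Infinite_Sum.abs_summable_on_comparison_test)
      (use measure_restricted_level_set_le(1)[OF gs E] in
        \<open>auto simp: measure_restrict_level_set[OF E] intro!: mult_right_mono\<close>)
  with gs show ?thesis
    by (simp add: simple_map_integrable_def simple_map_restrict_space)
qed

text \<open>The point is that \<open>C\<close> depends on \<open>g\<close> and \<eta> but not on
  \<open>E\<close>, so that \<delta> can later be fixed before \<open>E\<close>.\<close>

lemma norm_simple_map_integral_restrict_space_le:
  fixes g :: "'a \<Rightarrow> 'b::banach"
  assumes g: "simple_map_integrable M g" and "0 < \<eta>"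
  obtains C where "0 \<le> C"
    and "\<And>E. E \<in> sets M \<Longrightarrow>
      norm (simple_map_integral (restrict_space M E) g) \<le> C * measure M E + \<eta>"
proof -
  define a where "a v = norm (measure M {x \<in> space M. g x = v} *\<^sub>R v)" for v
  have gs: "simple_map M g" and abs: "a summable_on (g ` space M)"
    using g by (simp_all add: simple_map_integrable_def a_def[abs_def])
  \<comment> \<open>\<open>F\<close> is chosen for the series over the whole space, before any
    \<open>E\<close> is given.\<close>
  obtain F where F: "finite F" "F \<subseteq> g ` space M"
    and "dist (sum a F) (infsum a (g ` space M)) \<le> \<eta>"
    using infsum_finite_approximation[OF abs \<open>0 < \<eta>\<close>] by blast
  then have "infsum a (g ` space M) - infsum a F \<le> \<eta>"
    by (simp add: dist_real_def)
  then have tail: "infsum a (g ` space M - F) \<le> \<eta>"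
    using infsum_Diff[OF abs _ F(2)] F(1) by simp
  show thesis
  proof (rule that[of "\<Sum>v\<in>F. norm v"])
    show "0 \<le> (\<Sum>v\<in>F. norm v)" by (simp add: sum_nonneg)
  next
    fix E assume E: "E \<in> sets M"
    define b where "b v = norm (measure M {x \<in> E. g x = v} *\<^sub>R v)" for v
    have b0: "0 \<le> b v" for v by (simp add: b_def)
    have ba: "b v \<le> a v" and bE: "b v \<le> norm v * measure M E" for v
      using measure_restricted_level_set_le[OF gs E, of v]
      by (simp_all add: a_def b_def mult_right_mono mult.commute[of "norm v"])
    have sp: "space (restrict_space M E) \<subseteq> space M"
      by (auto simp: space_restrict_space)
    have bs: "b summable_on S" if "S \<subseteq> g ` space M" for S
      using summable_on_comparison_test[OF summable_on_subset_banach[OF abs that]] ba b0 by blast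
    let ?R = "g ` space (restrict_space M E)"
    have R: "?R \<subseteq> g ` space M" using sp by blast
    have "norm (simple_map_integral (restrict_space M E) g) \<le> infsum b ?R"
      unfolding simple_map_integral_def measure_restrict_level_set[OF E] b_def
      using bs[OF R] by (intro norm_infsum_bound) (simp only: b_def[abs_def])
    also have "\<dots> \<le> infsum b (F \<union> (g ` space M - F))"
      using R F b0 by (intro infsum_mono_neutral bs) auto
    also have "\<dots> = sum b F + infsum b (g ` space M - F)"
      using F by (subst infsum_Un_disjoint) (auto intro: bs)
    also have "\<dots> \<le> (\<Sum>v\<in>F. norm v * measure M E) + infsum a (g ` space M - F)"
      by (intro add_mono sum_mono bE infsum_mono bs summable_on_subset_banach[OF abs] ba) auto
    also have "\<dots> \<le> (\<Sum>v\<in>F. norm v) * measure M E + \<eta>"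
      using tail by (simp add: sum_distrib_right)
    finally show "norm (simple_map_integral (restrict_space M E) g)
        \<le> (\<Sum>v\<in>F. norm v) * measure M E + \<eta>" .
  qed
qed

end

section \<open>Absolute continuity of the integral\<close>

theorem theorem4p3p7:
  fixes M :: "'x measure"
    and Omega :: "'w set"
    and arity :: "'w \<Rightarrow> nat"
    and opn :: "'w \<Rightarrow> 'a::banach list \<Rightarrow> 'a"
    and f :: "'x \<Rightarrow> 'a"
  assumes "finite_measure M"
    and "complete_measure M"
    and "abelian_omega_group Omega arity opn"
    and "map_integrable M f"
  shows "\<forall>\<epsilon>::real. \<epsilon> > 0 \<longrightarrow>
    (\<exists>\<delta>::real. \<delta> > 0 \<and>
      (\<forall>E \<in> sets M. measure M E < \<delta> \<longrightarrow> norm (map_integral_over M E f) < \<epsilon>))"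
proof (intro allI impI)
  interpret finite_measure M by fact
  fix \<epsilon> :: real assume \<epsilon>: "0 < \<epsilon>"
  obtain g where g: "simple_approximation M f g"
    using assms(4) by (auto simp: map_integrable_def)
  then have gi: "simple_map_integrable M (g n)" for n
    by (simp add: simple_approximation_def)
  have "\<forall>\<^sub>F n in sequentially. \<forall>x\<in>space M. dist (g n x) (f x) < 1/2"
    using g by (intro uniform_limitD) (simp_all add: simple_approximation_def)
  \<comment> \<open>With 1/2 here, any two approximants from index \<open>N\<close> on differ by at
    most 1.\<close>
  then obtain N where N: "\<And>n x. n \<ge> N \<Longrightarrow> x \<in> space M \<Longrightarrow> dist (g n x) (f x) < 1/2"
    unfolding eventually_sequentially by blast
  obtain C where C: "0 \<le> C" and bound: "\<And>E. E \<in> sets M \<Longrightarrow>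
      norm (simple_map_integral (restrict_space M E) (g N)) \<le> C * measure M E + \<epsilon> / 2"
    using norm_simple_map_integral_restrict_space_le[OF gi[of N], of "\<epsilon> / 2"] \<epsilon> by auto
  \<comment> \<open>This makes \<open>(C + 1) * \<delta>\<close> equal to \<epsilon>/2. The 1 added
    to \<open>C\<close> pays for replacing \<open>g n\<close> by \<open>g N\<close> on
    \<open>E\<close>, and keeps the denominator positive.\<close>
  define \<delta> where "\<delta> = \<epsilon> / (2 * (C + 1))"
  have "norm (map_integral_over M E f) < \<epsilon>" if E: "E \<in> sets M" and small: "measure M E < \<delta>" for E
  proof -
    let ?R = "restrict_space M E"
    have E': "E \<inter> space M \<in> sets M" using E by auto
    have sp: "space ?R \<subseteq> space M" by (auto simp: space_restrict_space)
    have mE: "measure ?R (space ?R) = measure M E"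
      using measure_restrict_space[OF E', of "space ?R"] sets.sets_into_space[OF E]
      by (simp add: space_restrict_space Int_absorb2)
    interpret R: finite_measure ?R
      using finite_measure_axioms E by (rule finite_measure_restrict_space)
    have gR: "simple_map_integrable ?R (g n)" for n
      using gi E by (rule simple_map_integrable_restrict_space)
    \<comment> \<open>Uniform convergence survives restriction, so one sequence chosen on the whole
      space computes the integral over every \<open>E\<close>.\<close>
    have "simple_approximation ?R f g"
      using g gR uniform_limit_on_subset[OF _ sp] by (auto simp: simple_approximation_def)
    then have lim: "(\<lambda>n. simple_map_integral ?R (g n)) \<longlonglongrightarrow> map_integral_over M E f"
      unfolding map_integral_over_def by (rule R.map_integral_limit)
    \<comment> \<open>The bound does not depend on \<open>n\<close>, so it passes to the limit as a
      weak inequality; strictness comes afterwards from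
      \<open>measure M E < \<delta>\<close>.\<close>
    have "norm (simple_map_integral ?R (g n)) \<le> (C + 1) * measure M E + \<epsilon> / 2" if "n \<ge> N" for n
    proof -
      have "norm (g n x - g N x) \<le> 1" if "x \<in> space ?R" for x
        using N[of n x] N[of N x] \<open>n \<ge> N\<close> that sp dist_triangle2[of "g n x" "g N x" "f x"]
        by (auto simp: dist_norm)
      from R.norm_simple_map_integral_diff_le[OF gR gR this]
      have "norm (simple_map_integral ?R (g n) - simple_map_integral ?R (g N)) \<le> measure M E"
        by (simp add: mE)
      then show ?thesis
        using bound[OF E] norm_triangle_sub[of "simple_map_integral ?R (g n)" "simple_map_integral ?R (g N)"]
        by (simp add: algebra_simps)
    qed
    then have "norm (map_integral_over M E f) \<le> (C + 1) * measure M E + \<epsilon> / 2"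
      by (intro LIMSEQ_le_const2[OF tendsto_norm[OF lim]]) blast
    also have "\<dots> < (C + 1) * \<delta> + \<epsilon> / 2"
      using small C by simp
    also have "\<dots> = \<epsilon>"
      using C by (simp add: \<delta>_def field_simps)
    finally show ?thesis .
  qed
  moreover have "0 < \<delta>"
    using \<epsilon> C by (simp add: \<delta>_def)
  ultimately show "\<exists>\<delta>>0. \<forall>E\<in>sets M. measure M E < \<delta> \<longrightarrow> norm (map_integral_over M E f) < \<epsilon>"
    by blast
qed

end
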